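(* Let $N\ge 1$ and let $\mathcal{I}$ be a nonempty finite multiset of permutations in $\mathfrak{S}_N$ that defines a strategy-indifferent game of best choice. Let $\mathcal{J}=\{\pi\in\mathcal{I}:\pi_N=N\}$ (with multiplicities inherited from $\mathcal{I}$). Then the win probability of the game (the common probability of winning over all strategies whose strike set is a maximal antichain of $\mathcal{P}_N$) is $$\frac{|\mathcal{J}|}{|\mathcal{I}|}=\frac{\sum_{\pi\in\mathcal{J}}1}{\sum_{\pi\in\mathcal{J}}\mathrm{lrm}(\pi)},$$ where $\mathrm{lrm}(\pi)$ is the number of left-to-right maxima of $\pi$ and sums are taken with multiplicity.
   Context: $\mathfrak{S}_N$ is the set of permutations of $\{1,\dots,N\}$ in one-line notation. The flattening of a sequence of $i$ distinct integers is the unique permutation of $\{1,\dots,i\}$ with the same relative order. For a permutation $\pi$, $\pi|_{[i]}$ denotes the flattening of $\pi_1,\dots,\pi_i$. Game of best choice defined by a multiset $\mathcal{I}$ of elements of $\mathfrak{S}_N$: $\pi\in\mathcal{I}$ is chosen uniformly at random (each element weighted by its multiplicity; $|\mathcal{I}|$ is the sum of the multiplicities), and $\pi|_{[1]},\pi|_{[2]},\dots$ are presented sequentially to the player, who may stop at one position. The player wins if they stop at position $i$ with $\pi_i=N$, and loses otherwise. A strategy is given by a strike set $A$ of prefixes: the player stops at the first $i$ for which $\pi|_{[i]}\in A$ (and loses if there is no such $i$). An entry $\pi_j$ is a left-to-right maximum if $\pi_i<\pi_j$ for all $i<j$. A permutation in $\bigcup_{i=1}^N\mathfrak{S}_i$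 is an eligible prefix if its last entry is a left-to-right maximum. The prefix tree $\mathcal{P}_N$ is the set of all eligible prefixes in $\bigcup_{i=1}^N\mathfrak{S}_i$, partially ordered by containment: $q$ contains $p$ if $q|_{[i]}=p$, where $i$ is the size of $p$. A maximal antichain in $\mathcal{P}_N$ is a subset $A\subseteq\mathcal{P}_N$ with no two distinct elements comparable and such that every element of $\mathcal{P}_N$ contains or is contained in some element of $A$. $\mathcal{I}$ is strategy-indifferent if every strike set that is a maximal antichain in $\mathcal{P}_N$ has the same probability of winning the game defined by $\mathcal{I}$. *)

theory Defs
  imports "HOL-Probability.Probability" "HOL-Combinatorics.Multiset_Permutations"
begin

(* A permutation of {1..n} in one-line notation is a list in permutations_of_set {1..n}.
   The entry pi_i of the one-line notation, counted from 1, is "\<pi> ! (i - 1)". *)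

definition flatten :: "nat list \<Rightarrow> nat list" where
  "flatten xs = (THE ys. ys \<in> permutations_of_set {1..length xs} \<and>
     (\<forall>i<length xs. \<forall>j<length xs. ys ! i < ys ! j \<longleftrightarrow> xs ! i < xs ! j))"

definition restrict_prefix :: "nat list \<Rightarrow> nat \<Rightarrow> nat list" where
  "restrict_prefix \<pi> i = flatten (take i \<pi>)"

(* Here j is a list index, counted from 0. *)
definition lr_max_at :: "nat list \<Rightarrow> nat \<Rightarrow> bool" where
  "lr_max_at \<pi> j \<longleftrightarrow> j < length \<pi> \<and> (\<forall>i<j. \<pi> ! i < \<pi> ! j)"

definition lrm :: "nat list \<Rightarrow> nat" where
  "lrm \<pi> = card {j. lr_max_at \<pi> j}"

definition prefix_tree :: "nat \<Rightarrow> nat list set" where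
  "prefix_tree N = {p \<in> (\<Union>i\<in>{1..N}. permutations_of_set {1..i}). lr_max_at p (length p - 1)}"

definition contains :: "nat list \<Rightarrow> nat list \<Rightarrow> bool" where
  "contains q p \<longleftrightarrow> restrict_prefix q (length p) = p"

definition maximal_antichain :: "nat \<Rightarrow> nat list set \<Rightarrow> bool" where
  "maximal_antichain N A \<longleftrightarrow>
     A \<subseteq> prefix_tree N \<and>
     (\<forall>p\<in>A. \<forall>q\<in>A. p \<noteq> q \<longrightarrow> \<not> contains p q \<and> \<not> contains q p) \<and>
     (\<forall>p\<in>prefix_tree N. \<exists>q\<in>A. contains p q \<or> contains q p)"

definition stops_at :: "nat list set \<Rightarrow> nat list \<Rightarrow> nat \<Rightarrow> bool" where
  "stops_at A \<pi> i \<longleftrightarrow> i \<in> {1..length \<pi>} \<and> restrict_prefix \<pi> i \<in> A \<and>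
     (\<forall>j\<in>{1..<i}. restrict_prefix \<pi> j \<notin> A)"

definition wins :: "nat \<Rightarrow> nat list set \<Rightarrow> nat list \<Rightarrow> bool" where
  "wins N A \<pi> \<longleftrightarrow> (\<exists>i. stops_at A \<pi> i \<and> \<pi> ! (i - 1) = N)"

definition win_prob :: "nat \<Rightarrow> nat list multiset \<Rightarrow> nat list set \<Rightarrow> real" where
  "win_prob N \<I> A = measure_pmf.prob (pmf_of_multiset \<I>) {\<pi>. wins N A \<pi>}"

definition strategy_indifferent :: "nat \<Rightarrow> nat list multiset \<Rightarrow> bool" where
  "strategy_indifferent N \<I> \<longleftrightarrow>
     (\<forall>A B. maximal_antichain N A \<longrightarrow> maximal_antichain N B \<longrightarrow> win_prob N \<I> A = win_prob N \<I> B)"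

lemma same_order_unique:
  fixes ys zs :: "nat list"
  assumes ys: "ys \<in> permutations_of_set {1..n}" and zs: "zs \<in> permutations_of_set {1..n}"
    and eq: "\<And>i j. i < n \<Longrightarrow> j < n \<Longrightarrow> ys ! i < ys ! j \<longleftrightarrow> zs ! i < zs ! j"
  shows "ys = zs"
proof -
  have rank: "ws ! i = Suc (card {j. j < n \<and> ws ! j < ws ! i})"
    if ws: "ws \<in> permutations_of_set {1..n}" and i: "i < n" for ws :: "nat list" and i
  proof -
    from ws have d: "distinct ws" and s: "set ws = {1..n}"
      by (auto simp: permutations_of_set_def)
    have l: "length ws = n" using distinct_card[OF d] s by simp
    have mem: "ws ! i \<in> {1..n}" using s i l nth_mem by metis
    have "(\<lambda>j. ws ! j) ` {j. j < n \<and> ws ! j < ws ! i} = {1..<ws ! i}"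
    proof (intro equalityI subsetI)
      fix x assume "x \<in> (\<lambda>j. ws ! j) ` {j. j < n \<and> ws ! j < ws ! i}"
      then obtain j where "j < n" "x = ws ! j" "x < ws ! i" by auto
      then show "x \<in> {1..<ws ! i}" using s l nth_mem[of j ws] by auto
    next
      fix x assume "x \<in> {1..<ws ! i}"
      then have "x \<in> set ws" and "x < ws ! i" using s mem by auto
      then show "x \<in> (\<lambda>j. ws ! j) ` {j. j < n \<and> ws ! j < ws ! i}"
        using l by (auto simp: in_set_conv_nth)
    qed
    moreover have "inj_on (\<lambda>j. ws ! j) {j. j < n \<and> ws ! j < ws ! i}"
      using d l by (auto simp: inj_on_def nth_eq_iff_index_eq)
    ultimately have "card {j. j < n \<and> ws ! j < ws ! i} = ws ! i - 1"
      using card_image by fastforce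
    then show ?thesis using mem by simp
  qed
  have "length ys = n" "length zs = n"
    using ys zs by (auto simp: length_finite_permutations_of_set)
  moreover have "ys ! i = zs ! i" if "i < n" for i
  proof -
    have "{j. j < n \<and> ys ! j < ys ! i} = {j. j < n \<and> zs ! j < zs ! i}" using eq that by auto
    then show ?thesis using rank[OF ys that] rank[OF zs that] by simp
  qed
  ultimately show ?thesis by (simp add: list_eq_iff_nth_eq)
qed

lemma flatten_eq_ranks:
  assumes d: "distinct xs"
  shows "flatten xs = map (\<lambda>x. card {y \<in> set xs. y \<le> x}) xs" (is "_ = map ?r xs")
proof -
  let ?n = "length xs"
  have lt: "?r x < ?r y \<longleftrightarrow> x < y" if "x \<in> set xs" "y \<in> set xs" for x y
  proof -
    have strict: "?r a < ?r b" if "a < b" "b \<in> set xs" for a b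
    proof (rule psubset_card_mono)
      have "b \<in> {y \<in> set xs. y \<le> b}" "b \<notin> {y \<in> set xs. y \<le> a}" using that by auto
      moreover have "{y \<in> set xs. y \<le> a} \<subseteq> {y \<in> set xs. y \<le> b}" using that by auto
      ultimately show "{y \<in> set xs. y \<le> a} \<subset> {y \<in> set xs. y \<le> b}" by blast
    qed simp
    from strict[of x y] strict[of y x] that show ?thesis
      by (cases x y rule: linorder_cases) auto
  qed
  have inj: "inj_on ?r (set xs)"
  proof (rule inj_onI)
    fix x y assume "x \<in> set xs" "y \<in> set xs" "?r x = ?r y"
    then show "x = y" using lt[of x y] lt[of y x] by linarith
  qed
  have sub: "?r ` set xs \<subseteq> {1..?n}"
  proof
    fix k assume "k \<in> ?r ` set xs"
    then obtain x where x: "x \<in> set xs" "k = ?r x" by auto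
    have "x \<in> {y \<in> set xs. y \<le> x}" using x by auto
    then have "0 < ?r x" by (subst card_gt_0_iff) auto
    moreover have "?r x \<le> card (set xs)" by (rule card_mono) auto
    ultimately show "k \<in> {1..?n}" using x d by (simp add: distinct_card)
  qed
  have "card (?r ` set xs) = card {1..?n}"
    using card_image[OF inj] distinct_card[OF d] by (metis card_atLeastAtMost diff_Suc_1)
  with sub have "?r ` set xs = {1..?n}" by (intro card_subset_eq) simp_all
  moreover have "distinct (map ?r xs)" using d inj by (simp only: distinct_map simp_thms)
  ultimately have perm: "map ?r xs \<in> permutations_of_set {1..?n}"
    by (intro permutations_of_setI) (simp_all only: set_map)
  have ord: "(map ?r xs ! i < map ?r xs ! j) = (xs ! i < xs ! j)" if "i < ?n" "j < ?n" for i j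
    using lt[of "xs ! i" "xs ! j"] that by simp
  show ?thesis unfolding flatten_def
  proof (rule the_equality)
    show "map ?r xs \<in> permutations_of_set {1..?n} \<and>
      (\<forall>i<?n. \<forall>j<?n. map ?r xs ! i < map ?r xs ! j \<longleftrightarrow> xs ! i < xs ! j)"
      by (intro conjI allI impI perm ord)
  next
    fix ys assume ys: "ys \<in> permutations_of_set {1..?n} \<and>
      (\<forall>i<?n. \<forall>j<?n. ys ! i < ys ! j \<longleftrightarrow> xs ! i < xs ! j)"
    show "ys = map ?r xs"
    proof (rule same_order_unique[OF conjunct1[OF ys] perm])
      fix i j assume ij: "i < ?n" "j < ?n"
      have "ys ! i < ys ! j \<longleftrightarrow> xs ! i < xs ! j" using conjunct2[OF ys] ij by blast
      then show "(ys ! i < ys ! j) = (map ?r xs ! i < map ?r xs ! j)"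
        by (rule trans[OF _ ord[OF ij, symmetric]])
    qed
  qed
qed

lemma contains_singleton:
  assumes "p \<in> prefix_tree N"
  shows "contains p [1]"
proof -
  from assms obtain x xs where "p = x # xs"
    by (cases p) (auto simp: prefix_tree_def lr_max_at_def)
  moreover have "{y. y = x \<and> y \<le> x} = {x}" by auto
  ultimately show ?thesis by (simp add: contains_def restrict_prefix_def flatten_eq_ranks)
qed

(* Maximal antichains exist, so the common win probability of a strategy-indifferent
   game is well defined. *)
lemma maximal_antichain_singleton:
  assumes "N \<ge> 1"
  shows "maximal_antichain N {[1]}"
proof -
  have "[1] \<in> permutations_of_set {1..1::nat}" by (simp add: permutations_of_set_def)
  then have "[1] \<in> (\<Union>i\<in>{1..N}. permutations_of_set {1..i})"
    using assms by (intro UN_I[of 1]) auto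
  then have "[1] \<in> prefix_tree N" by (simp add: prefix_tree_def lr_max_at_def)
  then show ?thesis using contains_singleton by (auto simp: maximal_antichain_def)
qed

end

theory Submission
  imports Defs
begin

text \<open>For a prefix $p$ let $w(p)$ be the weight of those $\pi$ for which stopping at $p$ wins; a
  maximal antichain $A$ wins with weight $\sum_{p \in A} w(p)$. The leaves of the prefix tree are the
  permutations ending in $N$, and they form a maximal antichain of winning weight $|J|$. Replacing the
  leaves above $p$ by $p$ itself gives another maximal antichain, so indifference forces
  $w(p) = |\{\pi \in J : \pi \mbox{ contains } p\}|$. Summing over all $p$, the left-hand sides
  add up to $|I|$, because each $\pi$ is won at exactly one prefix, and the right-hand sides to
  $\sum_{\pi \in J} \mathrm{lrm}(\pi)$.\<close>

section \<open>Flattening and restriction to an initial segment\<close>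

lemma permutations_of_interval_D:
  assumes "p \<in> permutations_of_set {1..n::nat}"
  shows "length p = n" "distinct p" "set p = {1..n}"
  using assms by (auto simp: permutations_of_set_def dest: distinct_card)

text \<open>The rank of an entry within \<open>set xs\<close> is strictly increasing, hence
  injective, and a cardinality count makes it onto \<open>{1..length xs}\<close>. By
  \<open>same_order_unique\<close> the two properties determine the flattening, so identities
  between flattenings reduce to comparing relative orders.\<close>

lemma flatten_props:
  assumes d: "distinct xs"
  shows flatten_perm: "flatten xs \<in> permutations_of_set {1..length xs}"
    and flatten_less_iff: "\<And>i j. i < length xs \<Longrightarrow> j < length xs \<Longrightarrow>
      flatten xs ! i < flatten xs ! j \<longleftrightarrow> xs ! i < xs ! j"
proof -
  let ?r = "\<lambda>x. card {y \<in> set xs. y \<le> x}"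
  have strict: "?r a < ?r b" if "a < b" "b \<in> set xs" for a b
  proof (rule psubset_card_mono)
    have "b \<in> {y \<in> set xs. y \<le> b}" "b \<notin> {y \<in> set xs. y \<le> a}" using that by auto
    moreover have "{y \<in> set xs. y \<le> a} \<subseteq> {y \<in> set xs. y \<le> b}" using that by auto
    ultimately show "{y \<in> set xs. y \<le> a} \<subset> {y \<in> set xs. y \<le> b}" by blast
  qed simp
  have lt: "?r x < ?r y \<longleftrightarrow> x < y" if "x \<in> set xs" "y \<in> set xs" for x y
    using strict[of x y] strict[of y x] that by (cases x y rule: linorder_cases) auto
  have inj: "inj_on ?r (set xs)"
  proof (rule inj_onI)
    fix x y assume "x \<in> set xs" "y \<in> set xs" "?r x = ?r y"
    then show "x = y" using lt[of x y] lt[of y x] by linarith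
  qed
  have sub: "?r ` set xs \<subseteq> {1..length xs}"
  proof
    fix k assume "k \<in> ?r ` set xs"
    then obtain x where x: "x \<in> set xs" "k = ?r x" by auto
    then have "0 < k" by (auto simp: card_gt_0_iff)
    moreover have "?r x \<le> card (set xs)" by (rule card_mono) auto
    ultimately show "k \<in> {1..length xs}" using x d by (simp add: distinct_card)
  qed
  have "card (?r ` set xs) = card {1..length xs}"
    using card_image[OF inj] distinct_card[OF d] by simp
  with sub have "?r ` set xs = {1..length xs}" by (intro card_subset_eq) simp_all
  then show "flatten xs \<in> permutations_of_set {1..length xs}"
    unfolding flatten_eq_ranks[OF d] using d inj
    by (intro permutations_of_setI) (simp_all only: set_map distinct_map simp_thms)
  show "flatten xs ! i < flatten xs ! j \<longleftrightarrow> xs ! i < xs ! j"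
    if "i < length xs" "j < length xs" for i j
    using lt[of "xs ! i" "xs ! j"] that by (simp add: flatten_eq_ranks[OF d])
qed

lemma length_flatten: "distinct xs \<Longrightarrow> length (flatten xs) = length xs"
  by (simp add: flatten_eq_ranks)

lemma flatten_id:
  assumes "p \<in> permutations_of_set {1..n}"
  shows "flatten p = p"
  using same_order_unique[of "flatten p" n p] flatten_props[of p] assms
    permutations_of_interval_D[OF assms] by simp

lemma flatten_take_flatten:
  assumes d: "distinct xs"
  shows "flatten (take i (flatten xs)) = flatten (take i xs)"
proof -
  note len = length_flatten[OF d]
  have d': "distinct (flatten xs)" using permutations_of_interval_D flatten_perm[OF d] by blast
  show ?thesis
  proof (rule same_order_unique)
    \<comment> \<open>The \<open>min\<close> covers an \<open>i\<close> beyond the length of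
      \<open>xs\<close>.\<close>
    show "flatten (take i (flatten xs)) \<in> permutations_of_set {1..min (length xs) i}"
      "flatten (take i xs) \<in> permutations_of_set {1..min (length xs) i}"
      using flatten_perm[of "take i (flatten xs)"] flatten_perm[of "take i xs"] d d' len by simp_all
    show "flatten (take i (flatten xs)) ! a < flatten (take i (flatten xs)) ! b \<longleftrightarrow>
        flatten (take i xs) ! a < flatten (take i xs) ! b"
      if "a < min (length xs) i" "b < min (length xs) i" for a b
      using that d d' len by (simp add: flatten_less_iff)
  qed
qed

lemma length_restrict_prefix:
  "distinct \<pi> \<Longrightarrow> length (restrict_prefix \<pi> i) = min (length \<pi>) i"
  by (simp add: restrict_prefix_def length_flatten)

lemma restrict_prefix_restrict_prefix:
  "distinct \<pi> \<Longrightarrow> i \<le> j \<Longrightarrow> restrict_prefix (restrict_prefix \<pi> j) i = restrict_prefix \<pi> i"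
  by (simp add: restrict_prefix_def flatten_take_flatten min_absorb1)

lemma restrict_prefix_id:
  "p \<in> permutations_of_set {1..n} \<Longrightarrow> n \<le> k \<Longrightarrow> restrict_prefix p k = p"
  using flatten_id permutations_of_interval_D(1) by (simp add: restrict_prefix_def)

section \<open>Left-to-right maxima and the order of the prefix tree\<close>

lemma lr_max_at_restrict_prefix:
  assumes "distinct \<pi>" "j < i" "i \<le> length \<pi>"
  shows "lr_max_at (restrict_prefix \<pi> i) j \<longleftrightarrow> lr_max_at \<pi> j"
  using assms flatten_less_iff[of "take i \<pi>"]
  by (auto simp: lr_max_at_def restrict_prefix_def length_flatten)

lemma restrict_prefix_in_prefix_tree_iff:
  assumes "\<pi> \<in> permutations_of_set {1..N}" "1 \<le> i" "i \<le> N"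
  shows "restrict_prefix \<pi> i \<in> prefix_tree N \<longleftrightarrow> lr_max_at \<pi> (i - 1)"
proof -
  note D = permutations_of_interval_D[OF assms(1)]
  have "restrict_prefix \<pi> i \<in> permutations_of_set {1..i}"
    using flatten_perm[of "take i \<pi>"] D assms by (simp add: restrict_prefix_def min_absorb2)
  then show ?thesis
    using assms D length_restrict_prefix[of \<pi> i] lr_max_at_restrict_prefix[of \<pi> "i - 1" i]
    by (auto simp: prefix_tree_def)
qed

lemma prefix_treeD:
  assumes "p \<in> prefix_tree N"
  shows "p \<in> permutations_of_set {1..length p}" "1 \<le> length p" "length p \<le> N"
    "lr_max_at p (length p - 1)" "distinct p"
  using assms permutations_of_interval_D by (fastforce simp: prefix_tree_def)+

lemma finite_prefix_tree: "finite (prefix_tree N)"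
  by (simp add: prefix_tree_def)

text \<open>The shorter of two restrictions of \<open>l\<close> is a restriction of the longer one.
  This is what makes the containment order a tree.\<close>

lemma contains_common_upper:
  assumes "distinct l" "contains l p" "contains l q"
  shows "contains p q \<or> contains q p"
  using assms restrict_prefix_restrict_prefix[of l "length p" "length q"]
    restrict_prefix_restrict_prefix[of l "length q" "length p"]
    linear[of "length p" "length q"]
  by (auto simp: contains_def)

text \<open>A prefix of \<pi> is eligible exactly when it ends at a left-to-right maximum of \<pi>,
  and its length recovers that position.\<close>

lemma card_contained_prefixes:
  assumes "\<pi> \<in> permutations_of_set {1..N}"
  shows "card {p \<in> prefix_tree N. contains \<pi> p} = lrm \<pi>"
proof -
  note D = permutations_of_interval_D[OF assms]
  have "bij_betw (\<lambda>j. restrict_prefix \<pi> (Suc j)) {j. lr_max_at \<pi> j}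
          {p \<in> prefix_tree N. contains \<pi> p}"
  \<comment> \<open>List index \<open>j\<close> belongs to the prefix of length
    \<open>Suc j\<close>. The inverse subtracts 1 from the length, which is not truncated since
    eligible prefixes are nonempty.\<close>
  proof (rule bij_betw_byWitness[where f' = "\<lambda>p. length p - 1"])
    show "\<forall>j\<in>{j. lr_max_at \<pi> j}. length (restrict_prefix \<pi> (Suc j)) - 1 = j"
      using D by (auto simp: length_restrict_prefix lr_max_at_def)
    show "\<forall>p\<in>{p \<in> prefix_tree N. contains \<pi> p}. restrict_prefix \<pi> (Suc (length p - 1)) = p"
    proof clarify
      fix p assume p: "p \<in> prefix_tree N" "contains \<pi> p"
      then have "Suc (length p - 1) = length p" using prefix_treeD(2) by fastforce
      then show "restrict_prefix \<pi> (Suc (length p - 1)) = p" using p by (simp add: contains_def)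
    qed
    show "(\<lambda>j. restrict_prefix \<pi> (Suc j)) ` {j. lr_max_at \<pi> j}
        \<subseteq> {p \<in> prefix_tree N. contains \<pi> p}"
      using D assms restrict_prefix_in_prefix_tree_iff[OF assms]
      by (auto simp: contains_def length_restrict_prefix lr_max_at_def min_absorb2)
    show "(\<lambda>p. length p - 1) ` {p \<in> prefix_tree N. contains \<pi> p} \<subseteq> {j. lr_max_at \<pi> j}"
    proof clarify
      fix p assume p: "p \<in> prefix_tree N" "contains \<pi> p"
      then show "lr_max_at \<pi> (length p - 1)"
        using restrict_prefix_in_prefix_tree_iff[OF assms prefix_treeD(2,3)[OF p(1)]]
        by (simp add: contains_def)
    qed
  qed
  then show ?thesis by (simp add: lrm_def bij_betw_same_card)
qed

section \<open>Leaves and the maximal antichains built from them\<close>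

definition leaves :: "nat \<Rightarrow> nat list set" where
  "leaves N = {l \<in> permutations_of_set {1..N}. l ! (N - 1) = N}"

lemma lr_max_at_top:
  assumes "\<pi> \<in> permutations_of_set {1..N}" "k < N" "\<pi> ! k = N"
  shows "lr_max_at \<pi> k"
proof -
  note D = permutations_of_interval_D[OF assms(1)]
  have "\<pi> ! i < N" if "i < k" for i
  proof -
    have "\<pi> ! i \<in> {1..N}" using D that assms nth_mem[of i \<pi>] by auto
    moreover have "\<pi> ! i \<noteq> \<pi> ! k" using D that assms(2) nth_eq_iff_index_eq[of \<pi> i k] by simp
    ultimately show ?thesis using assms by simp
  qed
  then show ?thesis using D assms by (simp add: lr_max_at_def)
qed

lemma leaves_subset_prefix_tree:
  assumes "N \<ge> 1"
  shows "leaves N \<subseteq> prefix_tree N"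
proof
  fix l assume l: "l \<in> leaves N"
  then show "l \<in> prefix_tree N"
    using restrict_prefix_in_prefix_tree_iff[of l N N] lr_max_at_top[of l N "N - 1"] assms
    by (auto simp: leaves_def restrict_prefix_id)
qed

text \<open>Appending the missing values in increasing order leaves the beginning \<open>q\<close>
  unchanged and puts N last.\<close>

lemma prefix_below_leaf:
  assumes "q \<in> prefix_tree N"
  shows "\<exists>l\<in>leaves N. contains l q"
proof -
  note q = prefix_treeD[OF assms]
  note D = permutations_of_interval_D[OF q(1)]
  let ?l = "q @ [Suc (length q)..<Suc N]"
  have "set ?l = {1..N}" "distinct ?l" using D q by auto
  then have "?l \<in> permutations_of_set {1..N}" by (rule permutations_of_setI)
  moreover have "?l ! (N - 1) = N"
  proof (cases "length q = N")
    \<comment> \<open>Nothing is appended here. If N stood before the last position, the last entry,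
      being a left-to-right maximum, would exceed N.\<close>
    case True
    have "N \<in> set q" using D True q by simp
    then obtain i where i: "i < N" "q ! i = N" using True by (auto simp: in_set_conv_nth)
    moreover have "q ! (N - 1) \<in> set q" using q True by (intro nth_mem) simp
    ultimately have "i = N - 1"
      using q(4) D True unfolding lr_max_at_def
      by (metis Suc_diff_1 atLeastAtMost_iff leD less_Suc_eq q(2) not_gr_zero not_less_zero)
    then show ?thesis using i True by simp
  next
    case False
    then have "length q \<le> N - 1" using q(3) by simp
    then have "?l ! (N - 1) = [Suc (length q)..<Suc N] ! (N - 1 - length q)"
      by (simp only: nth_append leD if_False)
    also have "\<dots> = Suc (length q) + (N - 1 - length q)"
      using \<open>length q \<le> N - 1\<close> q(2,3) by (intro nth_upt) simp
    also have "\<dots> = N" using \<open>length q \<le> N - 1\<close> q(2,3) by simp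
    finally show ?thesis .
  qed
  moreover have "contains ?l q"
    using flatten_id[OF q(1)] by (simp add: contains_def restrict_prefix_def)
  ultimately show ?thesis by (auto simp: leaves_def simp del: upt_Suc)
qed

text \<open>A leaf has full size N, and restricting an eligible prefix to N entries changes nothing;
  so leaves are maximal in the tree.\<close>

lemma contains_leaf_eq:
  assumes "p \<in> prefix_tree N" "l \<in> leaves N" "contains p l"
  shows "p = l"
  using assms prefix_treeD[OF assms(1)] permutations_of_interval_D(1)[of l N]
  by (auto simp: contains_def leaves_def restrict_prefix_id)

lemma contains_refl: "p \<in> permutations_of_set {1..n} \<Longrightarrow> contains p p"
  using restrict_prefix_id permutations_of_interval_D(1) by (simp add: contains_def)

text \<open>For maximality, pick a leaf above the given \<open>q\<close>. Either it is retained, or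
  it contains both \<open>p\<close> and \<open>q\<close>, which are then comparable because they
  share an upper bound.\<close>

lemma maximal_antichain_replace_leaves:
  assumes "N \<ge> 1" "p \<in> prefix_tree N"
  shows "maximal_antichain N (insert p {l \<in> leaves N. \<not> contains l p})"
  unfolding maximal_antichain_def
proof (intro conjI)
  show "insert p {l \<in> leaves N. \<not> contains l p} \<subseteq> prefix_tree N"
    using assms leaves_subset_prefix_tree by auto
next
  have leaf: "l \<in> prefix_tree N" if "l \<in> leaves N" for l
    using that assms leaves_subset_prefix_tree by auto
  \<comment> \<open>Otherwise \<open>p\<close> would be the leaf \<open>l\<close> itself, and
    \<open>l\<close> would contain \<open>p\<close>.\<close>
  have "\<not> contains p l" if "l \<in> leaves N" "\<not> contains l p" for l
    using that contains_leaf_eq[OF assms(2)] contains_refl prefix_treeD(1)[OF assms(2)] by metis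
  moreover have "l = l'" if "l \<in> leaves N" "l' \<in> leaves N" "contains l l'" for l l'
    using that contains_leaf_eq leaf by blast
  ultimately show "\<forall>a\<in>insert p {l \<in> leaves N. \<not> contains l p}.
      \<forall>b\<in>insert p {l \<in> leaves N. \<not> contains l p}.
        a \<noteq> b \<longrightarrow> \<not> contains a b \<and> \<not> contains b a"
    by blast
next
  show "\<forall>q\<in>prefix_tree N. \<exists>a\<in>insert p {l \<in> leaves N. \<not> contains l p}. contains q a \<or> contains a q"
  proof
    fix q assume "q \<in> prefix_tree N"
    then obtain l where l: "l \<in> leaves N" "contains l q" using prefix_below_leaf by blast
    then have "distinct l" using permutations_of_interval_D(2) by (auto simp: leaves_def)
    then show "\<exists>a\<in>insert p {l \<in> leaves N. \<not> contains l p}. contains q a \<or> contains a q"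
      using l contains_common_upper[of l p q] by blast
  qed
qed

text \<open>Special case of the replacement in which \<open>p\<close> is itself a leaf: only that
  leaf is removed, and it is put back. The prefix \<open>[1]\<close> serves to produce some
  leaf.\<close>

lemma maximal_antichain_leaves:
  assumes "N \<ge> 1"
  shows "maximal_antichain N (leaves N)"
proof -
  have "[1::nat] \<in> prefix_tree N"
    using maximal_antichain_singleton[OF assms] by (simp add: maximal_antichain_def)
  then obtain l where l: "l \<in> leaves N" using prefix_below_leaf by blast
  then have "l \<in> prefix_tree N" using assms leaves_subset_prefix_tree by auto
  moreover have "insert l {l' \<in> leaves N. \<not> contains l' l} = leaves N"
    using l calculation contains_leaf_eq assms leaves_subset_prefix_tree by blast
  ultimately show ?thesis using maximal_antichain_replace_leaves[OF assms, of l] by simp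
qed

section \<open>The unique winning prefix of a permutation\<close>

definition top_prefix :: "nat \<Rightarrow> nat list \<Rightarrow> nat list" where
  "top_prefix N \<pi> = restrict_prefix \<pi> (Suc (length (takeWhile (\<lambda>x. x \<noteq> N) \<pi>)))"

lemma top_prefix_eq:
  assumes "\<pi> \<in> permutations_of_set {1..N}" "k < N" "\<pi> ! k = N"
  shows "top_prefix N \<pi> = restrict_prefix \<pi> (Suc k)"
proof -
  note D = permutations_of_interval_D[OF assms(1)]
  have "takeWhile (\<lambda>x. x \<noteq> N) \<pi> = take k \<pi>"
    using assms D by (intro takeWhile_eq_take_P_nth) (auto simp: nth_eq_iff_index_eq)
  then show ?thesis using assms D by (simp add: top_prefix_def)
qed

lemma permutation_top_index:
  assumes "\<pi> \<in> permutations_of_set {1..N}" "N \<ge> 1"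
  obtains k where "k < N" "\<pi> ! k = N"
proof -
  have "N \<in> set \<pi>" using permutations_of_interval_D[OF assms(1)] assms by simp
  then obtain k where "k < length \<pi>" "\<pi> ! k = N" by (auto simp: in_set_conv_nth)
  then show thesis using that permutations_of_interval_D(1)[OF assms(1)] by simp
qed

lemma top_prefix_in_prefix_tree:
  assumes "\<pi> \<in> permutations_of_set {1..N}" "N \<ge> 1"
  shows "top_prefix N \<pi> \<in> prefix_tree N"
proof -
  obtain k where k: "k < N" "\<pi> ! k = N" using permutation_top_index assms by blast
  then show ?thesis
    using lr_max_at_top[OF assms(1)] restrict_prefix_in_prefix_tree_iff[OF assms(1), of "Suc k"]
    by (simp add: top_prefix_eq[OF assms(1)])
qed

text \<open>A leaf has size N, so the winning prefix is a leaf only if N comes last; in that case it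
  is \<pi> itself. Thus the leaf antichain wins exactly on \<open>\<J>\<close>.\<close>

lemma top_prefix_in_leaves_iff:
  assumes "\<pi> \<in> permutations_of_set {1..N}" "N \<ge> 1"
  shows "top_prefix N \<pi> \<in> leaves N \<longleftrightarrow> \<pi> ! (N - 1) = N"
proof -
  obtain k where k: "k < N" "\<pi> ! k = N" using permutation_top_index assms by blast
  note D = permutations_of_interval_D[OF assms(1)]
  show ?thesis
  proof
    assume "top_prefix N \<pi> \<in> leaves N"
    then have "length (top_prefix N \<pi>) = N"
      using permutations_of_interval_D by (auto simp: leaves_def)
    then have "k = N - 1"
      using k D by (simp add: top_prefix_eq[OF assms(1)] length_restrict_prefix)
    then show "\<pi> ! (N - 1) = N" using k by simp
  next
    assume "\<pi> ! (N - 1) = N"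
    then show "top_prefix N \<pi> \<in> leaves N"
      using assms by (simp add: leaves_def top_prefix_eq[OF assms(1), of "N - 1"] restrict_prefix_id)
  qed
qed

lemma top_prefix_leaf:
  assumes "\<pi> \<in> leaves N" "N \<ge> 1"
  shows "top_prefix N \<pi> = \<pi>"
  using assms by (auto simp: leaves_def top_prefix_eq[of \<pi> N "N - 1"] restrict_prefix_id)

text \<open>For an antichain the player cannot have stopped before reaching a prefix in the strike
  set.\<close>

lemma wins_iff_top_prefix:
  assumes "maximal_antichain N A" "\<pi> \<in> permutations_of_set {1..N}" "N \<ge> 1"
  shows "wins N A \<pi> \<longleftrightarrow> top_prefix N \<pi> \<in> A"
proof -
  obtain k where k: "k < N" "\<pi> ! k = N" using permutation_top_index assms(2,3) by blast
  note D = permutations_of_interval_D[OF assms(2)]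
  note top = top_prefix_eq[OF assms(2) k]
  show ?thesis
  proof
    assume "wins N A \<pi>"
    then obtain i where i: "stops_at A \<pi> i" "\<pi> ! (i - 1) = N" by (auto simp: wins_def)
    then have "i - 1 = k"
      using k D nth_eq_iff_index_eq[of \<pi> "i - 1" k] by (auto simp: stops_at_def)
    \<comment> \<open>The subtraction can be undone because stopping positions start at 1.\<close>
    then have "i = Suc k" using i by (auto simp: stops_at_def)
    then show "top_prefix N \<pi> \<in> A" using i top by (simp add: stops_at_def)
  next
    assume A: "top_prefix N \<pi> \<in> A"
    have "restrict_prefix \<pi> j \<notin> A" if j: "1 \<le> j" "j < Suc k" for j
    proof
      assume *: "restrict_prefix \<pi> j \<in> A"
      have len: "length (restrict_prefix \<pi> j) = j" "length (top_prefix N \<pi>) = Suc k"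
        using j k D by (simp_all add: top length_restrict_prefix)
      then have "contains (top_prefix N \<pi>) (restrict_prefix \<pi> j)"
        using j D by (simp add: contains_def top restrict_prefix_restrict_prefix)
      then have "top_prefix N \<pi> = restrict_prefix \<pi> j"
        using A * assms(1) by (auto simp: maximal_antichain_def)
      then show False using len j by simp
    qed
    then have "stops_at A \<pi> (Suc k)" using A k D by (auto simp: stops_at_def top)
    then show "wins N A \<pi>" using k unfolding wins_def by (intro exI[of _ "Suc k"]) simp
  qed
qed

section \<open>Win probabilities as counts, and double counting\<close>

text \<open>The event may be infinite, so it is first intersected with the finite support, where its
  probability is a finite sum of multiplicities divided by the size.\<close>

lemma prob_pmf_of_multiset:
  assumes "M \<noteq> {#}"
  shows "measure_pmf.prob (pmf_of_multiset M) {x. P x} = size {#x \<in># M. P x#} / size M"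
proof -
  have "measure_pmf.prob (pmf_of_multiset M) {x. P x} =
      measure_pmf.prob (pmf_of_multiset M) ({x. P x} \<inter> set_pmf (pmf_of_multiset M))"
    by (simp add: measure_Int_set_pmf)
  also have "{x. P x} \<inter> set_pmf (pmf_of_multiset M) = set_mset {#x \<in># M. P x#}"
    using assms by auto
  also have "measure_pmf.prob (pmf_of_multiset M) \<dots> =
      (\<Sum>x\<in>set_mset {#x \<in># M. P x#}. count M x / size M)"
    using assms by (simp add: measure_measure_pmf_finite)
  also have "\<dots> = size {#x \<in># M. P x#} / size M"
    by (simp add: size_multiset_overloaded_eq sum_divide_distrib)
  finally show ?thesis .
qed

lemma win_prob_antichain:
  assumes "maximal_antichain N A" "N \<ge> 1" "set_mset \<I> \<subseteq> permutations_of_set {1..N}" "\<I> \<noteq> {#}"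
  shows "win_prob N \<I> A = size {#\<pi> \<in># \<I>. top_prefix N \<pi> \<in> A#} / size \<I>"
proof -
  have "{#\<pi> \<in># \<I>. wins N A \<pi>#} = {#\<pi> \<in># \<I>. top_prefix N \<pi> \<in> A#}"
    using assms wins_iff_top_prefix by (intro filter_mset_cong) auto
  then show ?thesis using assms(4) by (simp add: win_prob_def prob_pmf_of_multiset)
qed

text \<open>Double counting of the related pairs: adding one \<open>x\<close> to \<open>M\<close>
  raises by one precisely the summands with \<open>R x p\<close>.\<close>

lemma sum_size_filter_mset:
  assumes "finite S"
  shows "(\<Sum>p\<in>S. size {#x \<in># M. R x p#}) = (\<Sum>x\<in>#M. card {p \<in> S. R x p})"
proof (induction M)
  case (add x M)
  have "(\<Sum>p\<in>S. size {#y \<in># add_mset x M. R y p#}) =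
      (\<Sum>p\<in>S. size {#y \<in># M. R y p#} + (if R x p then 1 else 0))"
    by (intro sum.cong) auto
  also have "\<dots> = (\<Sum>p\<in>S. size {#y \<in># M. R y p#}) + card {p \<in> S. R x p}"
    using assms by (simp add: sum.distrib sum.If_cases Int_def)
  finally show ?case using add by simp
qed simp

section \<open>Comparison of antichains and summation over the prefix tree\<close>

theorem corollary2p4:
  fixes N :: nat and \<I> \<J> :: "nat list multiset"
  assumes "N \<ge> 1"
    and "set_mset \<I> \<subseteq> permutations_of_set {1..N}"
    and "\<I> \<noteq> {#}"
    and "strategy_indifferent N \<I>"
    and "\<J> = {# \<pi> \<in># \<I>. \<pi> ! (N - 1) = N #}"
  shows "(\<forall>A. maximal_antichain N A \<longrightarrow> win_prob N \<I> A = real (size \<J>) / real (size \<I>)) \<and>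
         (\<Sum>\<pi>\<in>#\<J>. lrm \<pi>) > 0 \<and>
         real (size \<J>) / real (size \<I>) = real (\<Sum>\<pi>\<in>#\<J>. 1) / real (\<Sum>\<pi>\<in>#\<J>. lrm \<pi>)"
proof -
  note win = win_prob_antichain[OF _ assms(1-3)]
  have leaves_iff: "top_prefix N \<pi> \<in> leaves N \<longleftrightarrow> \<pi> ! (N - 1) = N" if "\<pi> \<in># \<I>" for \<pi>
    using top_prefix_in_leaves_iff assms that by blast
  have J: "\<J> = {#\<pi> \<in># \<I>. top_prefix N \<pi> \<in> leaves N#}"
    unfolding assms(5) by (rule filter_mset_cong) (use leaves_iff in auto)
  have J_leaves: "\<pi> \<in> leaves N" if "\<pi> \<in># \<J>" for \<pi>
    using that assms by (auto simp: leaves_def)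
  have win_leaves: "win_prob N \<I> (leaves N) = size \<J> / size \<I>"
    using win[OF maximal_antichain_leaves[OF assms(1)]] by (simp add: J)
  have weight: "size {#\<pi> \<in># \<I>. top_prefix N \<pi> = p#} = size {#\<pi> \<in># \<J>. contains \<pi> p#}"
    if p: "p \<in> prefix_tree N" for p
  proof -
    let ?B = "{l \<in> leaves N. \<not> contains l p}"
    have "p \<notin> ?B" using contains_refl[OF prefix_treeD(1)[OF p]] by simp
    \<comment> \<open>The wins of the new antichain split into those at \<open>p\<close> and those
      at retained leaves; \<open>\<J>\<close> is split to match, by whether \<pi> contains
      \<open>p\<close>.\<close>
    then have "{#\<pi> \<in># \<I>. top_prefix N \<pi> \<in> insert p ?B#} =
        {#\<pi> \<in># \<I>. top_prefix N \<pi> = p#} + {#\<pi> \<in># \<I>. top_prefix N \<pi> \<in> ?B#}"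
      by (intro multiset_eqI) auto
    then have "size {#\<pi> \<in># \<I>. top_prefix N \<pi> \<in> insert p ?B#} =
        size {#\<pi> \<in># \<I>. top_prefix N \<pi> = p#} + size {#\<pi> \<in># \<I>. top_prefix N \<pi> \<in> ?B#}"
      by simp
    moreover have "size \<J> = size {#\<pi> \<in># \<J>. contains \<pi> p#} + size {#\<pi> \<in># \<J>. \<not> contains \<pi> p#}"
      using multiset_partition[of \<J>] size_union by metis
    \<comment> \<open>On \<open>\<J>\<close> the winning prefix is \<pi> itself. Phrased through
      \<open>top_prefix\<close>, the second part of \<open>\<J>\<close> becomes the wins at retained
      leaves, which then cancel.\<close>
    moreover have "{#\<pi> \<in># \<J>. \<not> contains \<pi> p#} = {#\<pi> \<in># \<J>. \<not> contains (top_prefix N \<pi>) p#}"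
      using top_prefix_leaf[OF J_leaves assms(1)] by (intro filter_mset_cong) auto
    moreover have "\<dots> = {#\<pi> \<in># \<I>. top_prefix N \<pi> \<in> ?B#}"
      by (simp add: J filter_filter_mset conj_commute)
    moreover have "win_prob N \<I> (insert p ?B) = win_prob N \<I> (leaves N)"
      using assms(4) maximal_antichain_replace_leaves[OF assms(1) p]
        maximal_antichain_leaves[OF assms(1)] unfolding strategy_indifferent_def by blast
    \<comment> \<open>Both probabilities have the nonzero denominator \<open>size \<I>\<close>, so
      the counts agree.\<close>
    then have "size {#\<pi> \<in># \<I>. top_prefix N \<pi> \<in> insert p ?B#} = size \<J>"
      using win[OF maximal_antichain_replace_leaves[OF assms(1) p]] win_leaves assms(3) by simp
    ultimately show ?thesis by simp
  qed
  have "size \<I> = (\<Sum>\<pi>\<in>#\<I>. card {p \<in> prefix_tree N. top_prefix N \<pi> = p})"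
  proof -
    have "card {p \<in> prefix_tree N. top_prefix N \<pi> = p} = 1" if "\<pi> \<in># \<I>" for \<pi>
    proof -
      have "{p \<in> prefix_tree N. top_prefix N \<pi> = p} = {top_prefix N \<pi>}"
        using top_prefix_in_prefix_tree[of \<pi> N] that assms by auto
      then show ?thesis by simp
    qed
    then show ?thesis by (simp cong: image_mset_cong)
  qed
  \<comment> \<open>Interchange the sums, apply \<open>weight\<close> at every prefix, then
    interchange back over \<open>\<J>\<close>.\<close>
  also have "\<dots> = (\<Sum>p\<in>prefix_tree N. size {#\<pi> \<in># \<J>. contains \<pi> p#})"
    unfolding sum_size_filter_mset[OF finite_prefix_tree, symmetric] by (simp add: weight)
  also have "\<dots> = (\<Sum>\<pi>\<in>#\<J>. card {p \<in> prefix_tree N. contains \<pi> p})"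
    by (rule sum_size_filter_mset[OF finite_prefix_tree])
  also have "\<dots> = (\<Sum>\<pi>\<in>#\<J>. lrm \<pi>)"
    using J_leaves card_contained_prefixes
    by (intro arg_cong[of _ _ sum_mset] image_mset_cong) (auto simp: leaves_def)
  finally have total: "size \<I> = (\<Sum>\<pi>\<in>#\<J>. lrm \<pi>)" .
  have "win_prob N \<I> A = size \<J> / size \<I>" if "maximal_antichain N A" for A
    using that assms(4) maximal_antichain_leaves[OF assms(1)] win_leaves
    unfolding strategy_indifferent_def by metis
  \<comment> \<open>By \<open>total\<close> the sum of \<open>lrm\<close> is
    \<open>size \<I>\<close>, so this gives its positivity, and both fractions have the same
    denominator.\<close>
  moreover have "size \<I> > 0" using assms(3) by (simp add: nonempty_has_size)
  ultimately show ?thesis unfolding total[symmetric] by simp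
qed

end
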